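(* For all integers $n,k\ge 1$, $$C^k_n(t,u)=A_n(t)\,N_{n,k}(t,u).$$ More specifically, for every permutation $\sigma\in\mathfrak{S}_n$, $$C^{k,\sigma}_n(t,u)=t^{\operatorname{des}(\sigma)}\,N_{n,k}(t,u).$$
   Context: Let $\mathfrak{S}_n$ be the set of permutations of $[n]=\{1,\dots,n\}$. For a word $\pi=\pi_1\cdots\pi_m$ over the positive integers, $\operatorname{Des}(\pi)=\{i\in[m-1]:\pi_i>\pi_{i+1}\}$, $\operatorname{Plat}(\pi)=\{i\in[m-1]:\pi_i=\pi_{i+1}\}$, $\operatorname{des}(\pi)=|\operatorname{Des}(\pi)|$, $\operatorname{plat}(\pi)=|\operatorname{Plat}(\pi)|$. The Eulerian polynomial is $A_n(t)=\sum_{\sigma\in\mathfrak{S}_n}t^{\operatorname{des}(\sigma)}$. A canon permutation is a permutation $\pi$ of the multiset $\{1^k,2^k,\dots,n^k\}$ ($k$ copies of each element of $[n]$) such that, for each $j\in[k]$, the subsequence of $\pi$ formed by the $j$th copy from the left of each number in $[n]$ is the same permutation $\sigma\in\mathfrak{S}_n$ for all $j$. Let $\mathcal{C}^k_n$ be the set of canon permutations and $\mathcal{C}^{k,\sigma}_n$ the subset of those for which this common subsequence is $\sigma$. Define $C^k_n(t,u)=\sum_{\pi\in\mathcal{C}^k_n}t^{\operatorname{des}(\pi)}u^{\operatorname{plat}(\pi)}$ and $C^{k,\sigma}_n(t,u)=\sum_{\pi\in\mathcal{C}^{k,\sigma}_n}t^{\operatorname{des}(\pi)}u^{\operatorname{plat}(\pi)}$.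 Let $\mathrm{SYT}(k^n)$ be the set of standard Young tableaux of rectangular shape with $n$ rows and $k$ columns (entries $1,\dots,kn$, increasing along rows left to right and down columns). For $T\in\mathrm{SYT}(k^n)$ and $i\in[kn]$, let $\operatorname{row}(i)$ be the index of the row containing $i$, rows indexed $1$ to $n$ from the top. Define $\operatorname{Asc}(T)=\{i\in[kn-1]:\operatorname{row}(i)>\operatorname{row}(i+1)\}$, $\operatorname{Plat}(T)=\{i\in[kn-1]:\operatorname{row}(i)=\operatorname{row}(i+1)\}$, $\operatorname{asc}(T)=|\operatorname{Asc}(T)|$, $\operatorname{plat}(T)=|\operatorname{Plat}(T)|$. The generalized Narayana polynomial is $N_{n,k}(t,u)=\sum_{T\in\mathrm{SYT}(k^n)}t^{\operatorname{asc}(T)}u^{\operatorname{plat}(T)}$. *)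

theory Defs
  imports "HOL-Combinatorics.Multiset_Permutations" "HOL-Computational_Algebra.Polynomial"
begin

text \<open>
  Words are lists; positions in the statistics are counted from 1, so the letter
  \<open>\<pi>\<^sub>i\<close> of a word is \<open>\<pi> ! (i - 1)\<close>.
\<close>

definition Des :: "nat list \<Rightarrow> nat set" where
  "Des \<pi> = {i \<in> {1..length \<pi> - 1}. \<pi> ! (i - 1) > \<pi> ! i}"

definition Plat :: "nat list \<Rightarrow> nat set" where
  "Plat \<pi> = {i \<in> {1..length \<pi> - 1}. \<pi> ! (i - 1) = \<pi> ! i}"

definition des :: "nat list \<Rightarrow> nat" where
  "des \<pi> = card (Des \<pi>)"

definition plat :: "nat list \<Rightarrow> nat" where
  "plat \<pi> = card (Plat \<pi>)"

definition Sym :: "nat \<Rightarrow> nat list set" where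
  "Sym n = permutations_of_set {1..n}"

definition eulerian_poly :: "nat \<Rightarrow> int poly" where
  "eulerian_poly n = (\<Sum>\<sigma>\<in>Sym n. monom 1 (des \<sigma>))"

text \<open>
  The subsequence of \<open>\<pi>\<close> formed by the \<open>j\<close>th copy from the left (\<open>j \<ge> 1\<close>) of each letter:
  the entry at 0-based position \<open>p\<close> is the \<open>j\<close>th copy of its letter iff that letter occurs
  exactly \<open>j\<close> times among the first \<open>p + 1\<close> entries.
\<close>

definition copies :: "nat \<Rightarrow> nat list \<Rightarrow> nat list" where
  "copies j \<pi> = nths \<pi> {p. count_list (take (Suc p) \<pi>) (\<pi> ! p) = j}"

definition canon_perms :: "nat \<Rightarrow> nat \<Rightarrow> nat list set" where
  "canon_perms n k =
     {\<pi> \<in> permutations_of_multiset (repeat_mset k (mset_set {1..n})).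
        \<exists>\<sigma>\<in>Sym n. \<forall>j\<in>{1..k}. copies j \<pi> = \<sigma>}"

definition canon_perms_at :: "nat \<Rightarrow> nat \<Rightarrow> nat list \<Rightarrow> nat list set" where
  "canon_perms_at n k \<sigma> = {\<pi> \<in> canon_perms n k. \<forall>j\<in>{1..k}. copies j \<pi> = \<sigma>}"

text \<open>
  Polynomials in \<open>t\<close> and \<open>u\<close> are elements of \<open>\<int>[t][u]\<close>: the inner variable is \<open>t\<close>, the outer
  one is \<open>u\<close>. A polynomial \<open>p\<close> in \<open>t\<close> alone becomes the constant \<open>[:p:]\<close>.
\<close>

definition monom_tu :: "nat \<Rightarrow> nat \<Rightarrow> int poly poly" where
  "monom_tu a b = monom (monom 1 a) b"

definition canon_poly :: "nat \<Rightarrow> nat \<Rightarrow> int poly poly" where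
  "canon_poly n k = (\<Sum>\<pi>\<in>canon_perms n k. monom_tu (des \<pi>) (plat \<pi>))"

definition canon_poly_at :: "nat \<Rightarrow> nat \<Rightarrow> nat list \<Rightarrow> int poly poly" where
  "canon_poly_at n k \<sigma> = (\<Sum>\<pi>\<in>canon_perms_at n k \<sigma>. monom_tu (des \<pi>) (plat \<pi>))"

text \<open>
  A tableau is the list of its rows from top to bottom. As there are \<open>k * n\<close> cells,
  covering \<open>{1..k * n}\<close> forces each entry to occur exactly once.
\<close>

definition SYT_rect :: "nat \<Rightarrow> nat \<Rightarrow> nat list list set" where
  "SYT_rect n k =
     {T. length T = n \<and> (\<forall>R\<in>set T. length R = k) \<and>
         set (concat T) = {1..k * n} \<and>
         (\<forall>r<n. \<forall>c. Suc c < k \<longrightarrow> T ! r ! c < T ! r ! Suc c) \<and>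
         (\<forall>r. \<forall>c<k. Suc r < n \<longrightarrow> T ! r ! c < T ! Suc r ! c)}"

definition row :: "nat list list \<Rightarrow> nat \<Rightarrow> nat" where
  "row T i = (THE r. r \<in> {1..length T} \<and> i \<in> set (T ! (r - 1)))"

text \<open>\<open>length (concat T)\<close> is the number of cells.\<close>

definition Asc_tab :: "nat list list \<Rightarrow> nat set" where
  "Asc_tab T = {i \<in> {1..length (concat T) - 1}. row T i > row T (i + 1)}"

definition Plat_tab :: "nat list list \<Rightarrow> nat set" where
  "Plat_tab T = {i \<in> {1..length (concat T) - 1}. row T i = row T (i + 1)}"

definition asc_tab :: "nat list list \<Rightarrow> nat" where
  "asc_tab T = card (Asc_tab T)"

definition plat_tab :: "nat list list \<Rightarrow> nat" where
  "plat_tab T = card (Plat_tab T)"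

definition narayana_poly :: "nat \<Rightarrow> nat \<Rightarrow> int poly poly" where
  "narayana_poly n k = (\<Sum>T\<in>SYT_rect n k. monom_tu (asc_tab T) (plat_tab T))"

end

theory Submission
  imports Defs
begin

text \<open>
  Reading off the rows of \<open>1, 2, \<dots>\<close> turns a tableau into a ballot word \<open>w\<close>, and the canon
  permutations belonging to \<open>\<sigma>\<close> are the words \<open>\<sigma> \<circ> w\<close>. Let \<open>\<tau>\<close> be the list of the positions of
  \<open>\<sigma>\<close> ordered by their values; \<open>\<sigma> \<circ> w\<close> has a descent where \<open>w\<close> steps to a letter occurring
  earlier in \<open>\<tau>\<close>. Two moves on \<open>\<tau>\<close> are harmless. Moving the first letter \<open>x\<close> of \<open>\<tau>\<close> to its end
  turns the steps out of \<open>x\<close> into descents and those into \<open>x\<close> into ascents, which changes the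
  descent number of every \<open>w\<close> by the same amount, because all ballot words have the same first
  and the same last letter. Exchanging adjacent letters \<open>x, y\<close> of \<open>\<tau>\<close> with \<open>|x - y| \<ge> 2\<close> is
  compensated by reversing every maximal run of letters \<open>x, y\<close> in \<open>w\<close>; this keeps the ballot
  property, which only relates consecutive letters. These moves lead from any \<open>\<tau>\<close> to the identity
  (this is the conjugacy of the Coxeter elements of type A): the largest letter can be moved to any
  position, since cyclically only one letter does not commute with it. The constant by which the
  descent numbers are shifted in total is read off from \<open>w = 0, 1, \<dots>, n - 1\<close>.
\<close>

section \<open>Counting adjacent pairs in words\<close>

fun adj_count :: "('a \<Rightarrow> 'a \<Rightarrow> bool) \<Rightarrow> 'a list \<Rightarrow> nat" where
  "adj_count R (a # b # w) = (if R a b then 1 else 0) + adj_count R (b # w)"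
| "adj_count R _ = 0"

lemma adj_count_Cons:
  "adj_count R (a # w) = (if w \<noteq> [] \<and> R a (hd w) then 1 else 0) + adj_count R w"
  by (cases w) auto

lemma adj_count_append:
  "adj_count R (v @ w) = adj_count R v + adj_count R w + (if v \<noteq> [] \<and> w \<noteq> [] \<and> R (last v) (hd w) then 1 else 0)"
  by (induction v) (auto simp: adj_count_Cons)

lemma adj_count_rev: "adj_count R (rev w) = adj_count (\<lambda>a b. R b a) w"
  by (induction w) (auto simp: adj_count_Cons adj_count_append last_rev)

lemma adj_count_map: "adj_count R (map f w) = adj_count (\<lambda>a b. R (f a) (f b)) w"
  by (induction w) (auto simp: adj_count_Cons hd_map)

text \<open>Links the recursion, which suits induction, to the cardinalities that define descents,
  plateaus and the tableau statistics.\<close>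

lemma adj_count_conv_card:
  "adj_count R w = card {i \<in> {1..length w - 1}. R (w ! (i - 1)) (w ! i)}"
proof (induction R w rule: adj_count.induct)
  case (1 R a b w)
  let ?S = "\<lambda>w. {i \<in> {1..length w - 1}. R (w ! (i - 1)) (w ! i)}"
  have "?S (a # b # w) = (if R a b then {1} else {}) \<union> Suc ` ?S (b # w)"
  proof (rule set_eqI)
    fix i
    show "i \<in> ?S (a # b # w) \<longleftrightarrow> i \<in> (if R a b then {1} else {}) \<union> Suc ` ?S (b # w)"
      by (cases i rule: nat.exhaust; cases "i - 1"; auto simp: image_iff)
  qed
  moreover have "card ((if R a b then {1} else {}) \<union> Suc ` ?S (b # w)) =
      (if R a b then 1 else 0) + card (Suc ` ?S (b # w))"
    by (subst card_Un_disjoint) auto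
  ultimately show ?case
    using 1 by (simp add: card_image)
qed auto

lemma adj_count_cong:
  assumes "\<And>a b. a \<in> set w \<Longrightarrow> b \<in> set w \<Longrightarrow> R a b = R' a b"
  shows "adj_count R w = adj_count R' w"
  using assms by (induction w) (auto simp: adj_count_Cons)

lemma adj_count_upt_cong:
  assumes "\<And>i. Suc i < n \<Longrightarrow> R i (Suc i) = R' i (Suc i)"
  shows "adj_count R [0..<n] = adj_count R' [0..<n]"
  unfolding adj_count_conv_card
proof (rule arg_cong[where f = card], rule Collect_cong, rule conj_cong[OF refl])
  fix i assume "i \<in> {1..length [0..<n] - 1}"
  with assms[of "i - 1"]
  show "R ([0..<n] ! (i - 1)) ([0..<n] ! i) = R' ([0..<n] ! (i - 1)) ([0..<n] ! i)"
    by auto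
qed

lemma des_conv_adj_count: "des w = adj_count (>) w"
  by (simp add: des_def Des_def adj_count_conv_card)

lemma plat_conv_adj_count: "plat w = adj_count (=) w"
  by (simp add: plat_def Plat_def adj_count_conv_card)

section \<open>Lists as linear orders, and rotation\<close>

fun before :: "'a list \<Rightarrow> 'a \<Rightarrow> 'a \<Rightarrow> bool" where
  "before [] a b = False"
| "before (x # xs) a b = (x = a \<and> b \<in> set xs \<or> before xs a b)"

lemma before_append:
  "before (xs @ ys) a b \<longleftrightarrow> before xs a b \<or> before ys a b \<or> a \<in> set xs \<and> b \<in> set ys"
  by (induction xs) auto

lemma before_imp_mem: "before xs a b \<Longrightarrow> a \<in> set xs \<and> b \<in> set xs"
  by (induction xs) auto

lemma before_sorted_wrt:
  fixes f :: "'a \<Rightarrow> 'b::linorder"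
  assumes "sorted_wrt (\<lambda>a b. f a < f b) xs" "a \<in> set xs" "b \<in> set xs"
  shows "before xs a b \<longleftrightarrow> f a < f b"
  using assms by (induction xs) (auto dest: before_imp_mem)

text \<open>For a list \<open>xs\<close> without repetitions this is the \<open>>\<close> of the
  linear order that \<open>xs\<close> spells out; \<open>adj_count (after xs)\<close> counts
  descents relative to it.\<close>

abbreviation after :: "'a list \<Rightarrow> 'a \<Rightarrow> 'a \<Rightarrow> bool" where
  "after xs a b \<equiv> before xs b a"

text \<open>The equation already holds for each single step from \<open>a\<close> to
  \<open>b\<close>, with \<open>a\<close> and \<open>b\<close> in place of the first and the last
  letter. Summing over the steps of \<open>w\<close> telescopes, so only the two ends of
  \<open>w\<close> remain.\<close>

lemma adj_count_rotate:
  assumes "distinct (x # xs)" "set w \<subseteq> set (x # xs)" "w \<noteq> []"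
  shows "adj_count (after (x # xs)) w + (if hd w = x then 1 else 0) =
         adj_count (after (xs @ [x])) w + (if last w = x then 1 else 0)"
  using assms(2,3)
proof (induction w)
  case (Cons a w)
  show ?case
  proof (cases "w = []")
    case False
    define b where "b = hd w"
    have b: "b \<in> set (x # xs)" and a: "a \<in> set (x # xs)"
      using Cons.prems hd_in_set[OF False] by (auto simp: b_def)
    have "\<not> before xs x c \<and> \<not> before xs c x" for c
      using assms(1) by (auto dest: before_imp_mem)
    then have "(if after (x # xs) a b then 1 else 0) + (if a = x then 1 else 0) =
       (if after (xs @ [x]) a b then 1 else 0) + (if b = x then 1 else (0::nat))"
      using a b assms(1) by (auto simp: before_append)
    with Cons False show ?thesis
      by (auto simp: adj_count_Cons b_def simp del: before.simps)
  qed simp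
qed simp

section \<open>Reversing maximal runs\<close>

text \<open>
  \<open>acc\<close> is the part of the current maximal run of \<open>P\<close>-letters read so far, in reverse.
\<close>

fun rev_runs :: "('a \<Rightarrow> bool) \<Rightarrow> 'a list \<Rightarrow> 'a list \<Rightarrow> 'a list" where
  "rev_runs P acc [] = acc"
| "rev_runs P acc (z # zs) =
     (if P z then rev_runs P (z # acc) zs else acc @ z # rev_runs P [] zs)"

lemma rev_runs_append:
  "list_all P xs \<Longrightarrow> rev_runs P acc (xs @ ys) = rev_runs P (rev xs @ acc) ys"
  by (induction xs arbitrary: acc) auto

text \<open>For \<open>acc = []\<close> this makes run reversal an involution, hence a bijection;
  the general accumulator is what the induction needs.\<close>

lemma rev_runs_rev_runs:
  "list_all P acc \<Longrightarrow> rev_runs P [] (rev_runs P acc w) = rev acc @ w"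
proof (induction w arbitrary: acc)
  case Nil
  then show ?case
    using rev_runs_append[of P acc "[]" "[]"] by simp
qed (simp add: rev_runs_append)

lemma rev_runs_eq_Nil_iff: "rev_runs P acc w = [] \<longleftrightarrow> acc = [] \<and> w = []"
  by (induction w arbitrary: acc) auto

text \<open>Runs keep their places and separators stay fixed. This is all that a step from a
  preceding separator can see of what follows it.\<close>

lemma hd_rev_runs:
  assumes "list_all P acc" "acc \<noteq> [] \<or> w \<noteq> []"
  shows "(P (hd (rev_runs P acc w)) \<longleftrightarrow> P (hd (acc @ w))) \<and>
         (P (hd (acc @ w)) \<or> hd (rev_runs P acc w) = hd (acc @ w))"
  using assms
proof (induction w arbitrary: acc)
  case (Cons z zs)
  show ?case
    using Cons.IH[of "z # acc"] Cons.prems by (cases acc) auto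
qed simp

text \<open>Steps inside a run are traversed backwards, which \<open>inside\<close> absorbs. At the
  border of a run the neighbouring separator now meets the opposite end of the run, but by
  \<open>left\<close> and \<open>right\<close> the relations do not depend on which
  \<open>P\<close>-letter it meets. All other steps are unchanged.\<close>

lemma adj_count_rev_runs:
  assumes inside: "\<And>a b. P a \<Longrightarrow> P b \<Longrightarrow> R a b = R' b a"
    and left: "\<And>a b z. P a \<Longrightarrow> P b \<Longrightarrow> \<not> P z \<Longrightarrow> R z a = R' z b"
    and right: "\<And>a b z. P a \<Longrightarrow> P b \<Longrightarrow> \<not> P z \<Longrightarrow> R a z = R' b z"
    and outside: "\<And>z z'. \<not> P z \<Longrightarrow> \<not> P z' \<Longrightarrow> R z z' = R' z z'"
    and acc: "list_all P acc"
  shows "adj_count R (rev acc @ w) = adj_count R' (rev_runs P acc w)"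
  using acc
proof (induction w arbitrary: acc)
  case Nil
  have "adj_count (\<lambda>a b. R b a) acc = adj_count R' acc"
    using Nil inside by (intro adj_count_cong) (auto simp: list_all_iff)
  then show ?case
    by (simp add: adj_count_rev)
next
  case (Cons z zs)
  show ?case
  proof (cases "P z")
    case True
    then show ?thesis
      using Cons.IH[of "z # acc"] Cons.prems by simp
  next
    case False
    have "adj_count (\<lambda>a b. R b a) acc = adj_count R' acc"
      using Cons.prems inside by (intro adj_count_cong) (auto simp: list_all_iff)
    moreover have "acc \<noteq> [] \<Longrightarrow> R (hd acc) z = R' (last acc) z"
      using Cons.prems False by (intro right) (auto simp: list_all_iff)
    moreover have "zs \<noteq> [] \<Longrightarrow> R z (hd zs) = R' z (hd (rev_runs P [] zs))"
      using hd_rev_runs[of P "[]" zs] False left outside by (cases "P (hd zs)") auto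
    ultimately show ?thesis
      using False Cons.IH[of "[]"]
      by (auto simp: adj_count_append adj_count_Cons adj_count_rev last_rev rev_runs_eq_Nil_iff)
  qed
qed

text \<open>In each run at most one letter, \<open>c\<close>, survives the filter, so what survives
  is a constant list and equals its own reversal.\<close>

lemma filter_rev_runs:
  assumes "\<And>a. P a \<Longrightarrow> Q a \<Longrightarrow> a = c" "list_all P acc"
  shows "filter Q (rev_runs P acc w) = filter Q (rev acc @ w)"
proof -
  have rev_filter_acc: "filter Q (rev acc) = filter Q acc" if "list_all P acc" for acc
  proof -
    have "filter Q acc = replicate (length (filter Q acc)) c"
      using that assms(1) by (intro replicate_eqI) (auto simp: list_all_iff)
    then show ?thesis
      by (metis rev_filter rev_replicate)
  qed
  show ?thesis
    using assms(2)
  proof (induction w arbitrary: acc)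
    case (Cons z zs)
    show ?case
    proof (cases "P z")
      case True
      then show ?thesis
        using Cons.IH[of "z # acc"] Cons.prems by simp
    next
      case False
      then show ?thesis
        using Cons.IH[of "[]"] rev_filter_acc[OF Cons.prems] by simp
    qed
  qed (simp add: rev_filter_acc)
qed

section \<open>Conjugating Coxeter words\<close>

text \<open>
  Conjugacy of the Coxeter elements \<open>\<Prod> s\<^sub>i\<close> whose factors are ordered by the given lists.
\<close>

inductive conj_equiv :: "nat list \<Rightarrow> nat list \<Rightarrow> bool" where
  refl: "conj_equiv xs xs"
| swap: "Suc x \<noteq> y \<Longrightarrow> Suc y \<noteq> x \<Longrightarrow> conj_equiv (us @ x # y # vs) (us @ y # x # vs)"
| rotate: "conj_equiv (x # xs) (xs @ [x])"
| trans: "conj_equiv xs ys \<Longrightarrow> conj_equiv ys zs \<Longrightarrow> conj_equiv xs zs"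

lemma conj_equiv_mset: "conj_equiv xs ys \<Longrightarrow> mset xs = mset ys"
  by (induction rule: conj_equiv.induct) auto

lemma conj_equiv_rotate_append: "conj_equiv (xs @ ys) (ys @ xs)"
proof (induction xs arbitrary: ys)
  case (Cons x xs)
  show ?case
    using conj_equiv.trans[OF conj_equiv.rotate[of x "xs @ ys"], of "ys @ x # xs"] Cons.IH[of "ys @ [x]"]
    by simp
qed (simp add: conj_equiv.refl)

text \<open>The letter \<open>z\<close> crosses \<open>xs\<close> one commutation at a time. Both
  directions are stated because \<open>conj_equiv\<close> has no symmetry rule.\<close>

lemma conj_equiv_move:
  assumes "\<And>x. x \<in> set xs \<Longrightarrow> Suc x \<noteq> z \<and> Suc z \<noteq> x"
  shows "conj_equiv (us @ xs @ z # vs) (us @ z # xs @ vs)"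
    and "conj_equiv (us @ z # xs @ vs) (us @ xs @ z # vs)"
  using assms
proof (induction xs arbitrary: us)
  case (Cons x xs)
  {
    case 1
    then show ?case
      using conj_equiv.trans[OF _ conj_equiv.swap[of x z us "xs @ vs"]] Cons.IH(1)[of "us @ [x]"]
      by simp
  next
    case 2
    then show ?case
      using conj_equiv.trans[OF conj_equiv.swap[of z x us "xs @ vs"]] Cons.IH(2)[of "us @ [x]"]
      by simp
  }
qed (simp_all add: conj_equiv.refl)

text \<open>Among the letters below \<open>n\<close> only \<open>n - 1\<close> fails to commute with
  \<open>n\<close>. If it is not in \<open>xs\<close>, then \<open>n\<close> crosses
  \<open>xs\<close> to the left; otherwise it is not in \<open>ys\<close>, so \<open>n\<close>
  crosses \<open>ys\<close> to the right and a rotation brings it to the front.\<close>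

lemma conj_equiv_move_max:
  assumes "distinct (xs @ ys)" "set (xs @ ys) \<subseteq> {..<n}"
  shows "conj_equiv (xs @ n # ys) (n # xs @ ys)"
proof (cases "n - 1 \<in> set xs")
  case False
  then have "Suc x \<noteq> n \<and> Suc n \<noteq> x" if "x \<in> set xs" for x
    using assms(2) that by auto
  from conj_equiv_move(1)[of xs n "[]" ys, OF this] show ?thesis
    by simp
next
  case True
  then have "Suc x \<noteq> n \<and> Suc n \<noteq> x" if "x \<in> set ys" for x
    using assms that by auto
  from conj_equiv_move(2)[of ys n xs "[]", OF this]
  have "conj_equiv (xs @ n # ys) ((xs @ ys) @ [n])"
    by simp
  moreover have "conj_equiv ((xs @ ys) @ [n]) ([n] @ xs @ ys)"
    by (rule conj_equiv_rotate_append)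
  ultimately show ?thesis
    using conj_equiv.trans by simp
qed

text \<open>Replays a chain of moves behind the letter \<open>n\<close>. Only a rotation is
  disturbed by \<open>n\<close>: it is imitated by rotating both \<open>n\<close> and
  \<open>x\<close> to the end and then moving \<open>n\<close> back to the front.\<close>

lemma conj_equiv_Cons_max:
  assumes "conj_equiv xs ys" "distinct xs" "set xs \<subseteq> {..<n}"
  shows "conj_equiv (n # xs) (n # ys)"
  using assms
proof (induction rule: conj_equiv.induct)
  case (swap x y us vs)
  then show ?case
    using conj_equiv.swap[of x y "n # us" vs] by simp
next
  case (rotate x xs)
  have "conj_equiv ([n, x] @ xs) (xs @ n # [x])"
    using conj_equiv_rotate_append[of "[n, x]" xs] by simp
  moreover have "conj_equiv (xs @ n # [x]) (n # xs @ [x])"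
    using rotate by (intro conj_equiv_move_max) auto
  ultimately show ?case
    using conj_equiv.trans by simp
next
  case (trans xs ys zs)
  have "distinct ys" "set ys \<subseteq> {..<n}"
    using trans.prems conj_equiv_mset[OF trans.hyps(1)]
    by (metis mset_eq_imp_distinct_iff, metis mset_eq_setD)
  with trans show ?case
    using conj_equiv.trans by blast
qed (rule conj_equiv.refl)

text \<open>Bring the largest letter to the front, sort the rest by induction, and rotate the
  largest letter to the end.\<close>

lemma conj_equiv_upt:
  assumes "distinct xs" "set xs = {..<n}"
  shows "conj_equiv xs [0..<n]"
  using assms
proof (induction n arbitrary: xs)
  case 0
  then show ?case
    by (simp add: conj_equiv.refl)
next
  case (Suc n)
  then obtain us vs where xs: "xs = us @ n # vs"
    by (metis lessThan_iff lessI split_list)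
  then have d: "distinct (us @ vs)" "n \<notin> set (us @ vs)"
    using Suc.prems by auto
  have s: "set (us @ vs) = {..<n}"
  proof -
    have "insert n (set (us @ vs)) = insert n {..<n}"
      using Suc.prems xs by (auto simp: lessThan_Suc)
    then show ?thesis
      using d(2) by (metis insert_ident lessThan_iff less_irrefl)
  qed
  have "conj_equiv xs (n # us @ vs)"
    unfolding xs using d s by (intro conj_equiv_move_max) auto
  moreover have "conj_equiv (n # us @ vs) (n # [0..<n])"
    using d s by (intro conj_equiv_Cons_max Suc.IH) auto
  moreover have "conj_equiv (n # [0..<n]) [0..<Suc n]"
    using conj_equiv.rotate[of n "[0..<n]"] by simp
  ultimately show ?case
    using conj_equiv.trans by blast
qed

section \<open>Ballot words\<close>

text \<open>Rows are numbered from 0 in the words, but from 1 in \<open>row\<close>.\<close>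

definition ballot :: "nat \<Rightarrow> nat list \<Rightarrow> bool" where
  "ballot r w \<longleftrightarrow>
     (\<forall>u v. w = u @ v \<longrightarrow> count_list u (Suc r) \<le> count_list u r)"

text \<open>The lattice (Yamanouchi) words of rectangular content.\<close>

definition ballot_words :: "nat \<Rightarrow> nat \<Rightarrow> nat list set" where
  "ballot_words n k =
     {w. set w \<subseteq> {..<n} \<and> (\<forall>r<n. count_list w r = k) \<and> (\<forall>r. Suc r < n \<longrightarrow> ballot r w)}"

lemma filter_eq_appendD:
  "filter P w = u @ v \<Longrightarrow> \<exists>u' v'. w = u' @ v' \<and> filter P u' = u \<and> filter P v' = v"
proof (induction u arbitrary: w)
  case Nil
  then show ?case
    by (metis append_Nil filter.simps(1))
next
  case (Cons a u)
  then obtain xs ys where w: "w = xs @ a # ys" "\<forall>x\<in>set xs. \<not> P x" "P a" "filter P ys = u @ v"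
    by (auto simp: filter_eq_Cons_iff)
  from Cons.IH[OF w(4)] obtain u' v' where "ys = u' @ v'" "filter P u' = u" "filter P v' = v"
    by blast
  with w show ?case
    by (intro exI[of _ "xs @ a # u'"] exI[of _ v']) (auto simp: filter_empty_conv)
qed

lemma count_list_filter: "P a \<Longrightarrow> count_list (filter P w) a = count_list w a"
  by (induction w) auto

text \<open>The prefixes of the filtered word are the filtered prefixes of \<open>w\<close>, and the
  filter keeps both counts. Hence the condition at \<open>r\<close> depends only on the subword of
  the letters \<open>r\<close> and \<open>Suc r\<close>.\<close>

lemma ballot_filter: "ballot r (filter (\<lambda>z. z = r \<or> z = Suc r) w) \<longleftrightarrow> ballot r w"
proof
  let ?P = "\<lambda>z. z = r \<or> z = Suc r"
  assume "ballot r (filter ?P w)"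
  then have "count_list (filter ?P u) (Suc r) \<le> count_list (filter ?P u) r" if "w = u @ v" for u v
    using that by (auto simp: ballot_def)
  then show "ballot r w"
    by (auto simp: ballot_def count_list_filter)
next
  let ?P = "\<lambda>z. z = r \<or> z = Suc r"
  assume b: "ballot r w"
  show "ballot r (filter ?P w)"
    unfolding ballot_def
  proof (intro allI impI)
    fix u v assume "filter ?P w = u @ v"
    from filter_eq_appendD[OF this] obtain u' v' where "w = u' @ v'" "filter ?P u' = u"
      by blast
    with b show "count_list u (Suc r) \<le> count_list u r"
      by (auto simp: ballot_def count_list_filter)
  qed
qed

lemma length_ballot_words:
  assumes "w \<in> ballot_words n k"
  shows "length w = k * n"
proof -
  have "length w = (\<Sum>r<n. count_list w r)"
    using assms by (intro sum_count_set[symmetric]) (auto simp: ballot_words_def)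
  also have "\<dots> = k * n"
    using assms by (simp add: ballot_words_def)
  finally show ?thesis .
qed

lemma hd_ballot_word:
  assumes w: "w \<in> ballot_words n k" and ne: "w \<noteq> []"
  shows "hd w = 0"
proof (cases "hd w")
  case (Suc r)
  have "hd w < n"
    using w hd_in_set[OF ne] unfolding ballot_words_def by blast
  then have "ballot r w"
    using w Suc by (simp add: ballot_words_def)
  moreover have "w = [Suc r] @ tl w"
    using ne Suc by (cases w) auto
  ultimately have "count_list [Suc r] (Suc r) \<le> count_list [Suc r] r"
    unfolding ballot_def by blast
  then show ?thesis
    by simp
qed

text \<open>If the last letter \<open>z\<close> had a successor below \<open>n\<close>, deleting it
  would leave a prefix with \<open>k\<close> copies of \<open>Suc z\<close> but only
  \<open>k - 1\<close> of \<open>z\<close>.\<close>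

lemma last_ballot_word:
  assumes w: "w \<in> ballot_words n k" and ne: "w \<noteq> []"
  shows "last w = n - 1"
proof (rule ccontr)
  obtain v z where w_eq: "w = v @ [z]"
    using ne by (cases w rule: rev_cases) auto
  then have "z < n"
    using w by (auto simp: ballot_words_def)
  moreover assume "last w \<noteq> n - 1"
  ultimately have z: "Suc z < n"
    using w_eq by simp
  have c: "count_list w z = k" "count_list w (Suc z) = k"
    using w z by (auto simp: ballot_words_def)
  have "ballot z w"
    using w z by (auto simp: ballot_words_def)
  then have "count_list v (Suc z) \<le> count_list v z"
    using w_eq unfolding ballot_def by blast
  with c w_eq show False
    by simp
qed

section \<open>Descent statistics up to a constant shift\<close>

text \<open>
  Evaluating both descent statistics at the word \<open>[0..<n]\<close> gives the constant by which they differ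
  after the bijection.
\<close>

definition shift_equiv :: "nat \<Rightarrow> nat \<Rightarrow> nat list \<Rightarrow> nat list \<Rightarrow> bool" where
  "shift_equiv n k xs ys \<longleftrightarrow>
     (\<exists>\<phi>. bij_betw \<phi> (ballot_words n k) (ballot_words n k) \<and>
        (\<forall>w\<in>ballot_words n k. adj_count (=) (\<phi> w) = adj_count (=) w \<and>
           adj_count (after xs) w + adj_count (after ys) [0..<n] =
           adj_count (after ys) (\<phi> w) + adj_count (after xs) [0..<n]))"

lemma shift_equiv_refl: "shift_equiv n k xs xs"
  unfolding shift_equiv_def by (rule exI[of _ id]) auto

lemma shift_equiv_trans:
  assumes "shift_equiv n k xs ys" "shift_equiv n k ys zs"
  shows "shift_equiv n k xs zs"
proof -
  let ?W = "ballot_words n k" and ?d = "\<lambda>xs. adj_count (after xs) [0..<n]"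
  obtain f where f: "bij_betw f ?W ?W"
    "\<And>w. w \<in> ?W \<Longrightarrow> adj_count (=) (f w) = adj_count (=) w"
    "\<And>w. w \<in> ?W \<Longrightarrow> adj_count (after xs) w + ?d ys = adj_count (after ys) (f w) + ?d xs"
    using assms(1) unfolding shift_equiv_def by blast
  obtain g where g: "bij_betw g ?W ?W"
    "\<And>w. w \<in> ?W \<Longrightarrow> adj_count (=) (g w) = adj_count (=) w"
    "\<And>w. w \<in> ?W \<Longrightarrow> adj_count (after ys) w + ?d zs = adj_count (after zs) (g w) + ?d ys"
    using assms(2) unfolding shift_equiv_def by blast
  have "f w \<in> ?W" if "w \<in> ?W" for w
    using f(1) that by (rule bij_betw_apply)
  then have "adj_count (=) ((g \<circ> f) w) = adj_count (=) w \<and>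
      adj_count (after xs) w + ?d zs = adj_count (after zs) ((g \<circ> f) w) + ?d xs" if "w \<in> ?W" for w
    using f(2,3)[OF that] g(2,3)[of "f w"] that by fastforce
  with bij_betw_trans[OF f(1) g(1)] show ?thesis
    unfolding shift_equiv_def by blast
qed

text \<open>The identity map suffices: the corrections in \<open>adj_count_rotate\<close> depend
  only on the end letters, which are \<open>0\<close> and \<open>n - 1\<close> for every ballot word
  and for \<open>[0..<n]\<close> alike. Positivity of \<open>k\<close> makes the ballot words
  nonempty.\<close>

lemma shift_equiv_rotate:
  assumes "distinct (x # xs)" "set (x # xs) = {..<n}" "k > 0"
  shows "shift_equiv n k (x # xs) (xs @ [x])"
  unfolding shift_equiv_def
proof (intro exI[of _ id] conjI ballI)
  fix w assume w: "w \<in> ballot_words n k"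
  have n: "n > 0"
    using assms(2) by (cases n) auto
  have upt: "adj_count (after (x # xs)) [0..<n] + (if 0 = x then 1 else 0) =
      adj_count (after (xs @ [x])) [0..<n] + (if n - 1 = x then 1 else 0)"
    using adj_count_rotate[OF assms(1), of "[0..<n]"] assms(2) n
    by (auto simp: atLeast0LessThan last_upt simp del: before.simps)
  show "adj_count (after (x # xs)) w + adj_count (after (xs @ [x])) [0..<n] =
      adj_count (after (xs @ [x])) (id w) + adj_count (after (x # xs)) [0..<n]"
  proof -
    have False: "w \<noteq> []"
      using w n assms(3) by (auto simp: ballot_words_def)
    have "set w \<subseteq> set (x # xs)"
      using w assms(2) by (simp add: ballot_words_def)
    then have "adj_count (after (x # xs)) w + (if 0 = x then 1 else 0) =
        adj_count (after (xs @ [x])) w + (if n - 1 = x then 1 else 0)"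
      using adj_count_rotate[OF assms(1) _ False] hd_ballot_word[OF w False] last_ballot_word[OF w False]
      by (simp del: before.simps)
    with upt show ?thesis
      unfolding id_apply by linarith
  qed
qed auto

lemma rev_runs_ballot_words:
  assumes "w \<in> ballot_words n k" "x \<noteq> y" "Suc x \<noteq> y" "Suc y \<noteq> x"
  shows "rev_runs (\<lambda>z. z = x \<or> z = y) [] w \<in> ballot_words n k"
proof -
  let ?P = "\<lambda>z. z = x \<or> z = y" and ?w = "rev_runs (\<lambda>z. z = x \<or> z = y) [] w"
  have count: "count_list ?w r = count_list w r" for r
    using filter_rev_runs[of ?P "(=) r" r "[]" w] by (simp add: count_list_eq_length_filter)
  then have "z \<in> set ?w \<longleftrightarrow> z \<in> set w" for z
    using count_list_0_iff[of ?w z] count_list_0_iff[of w z] by simp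
  then have "set ?w = set w"
    by blast
  moreover have "filter (\<lambda>z. z = r \<or> z = Suc r) ?w = filter (\<lambda>z. z = r \<or> z = Suc r) w" for r
  proof -
    have "filter (\<lambda>z. z = r \<or> z = Suc r) ?w = filter (\<lambda>z. z = r \<or> z = Suc r) (rev [] @ w)"
      \<comment> \<open>As \<open>x\<close> and \<open>y\<close> are not consecutive, at most one of
        them lies in the pair \<open>r\<close>, \<open>Suc r\<close>; \<open>c\<close> is that one,
        and is arbitrary if there is none.\<close>
      by (rule filter_rev_runs[where c = "if x = r \<or> x = Suc r then x else y"])
        (use assms(2-4) in auto)
    then show ?thesis
      by simp
  qed
  then have "ballot r ?w = ballot r w" for r
    by (metis ballot_filter)
  ultimately show ?thesis
    using assms(1) count by (simp add: ballot_words_def)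
qed

text \<open>The two orders disagree only on the pair \<open>x\<close>, \<open>y\<close>, and
  reversing the runs of these letters exchanges the steps from \<open>x\<close> to \<open>y\<close>
  with those from \<open>y\<close> to \<open>x\<close>.\<close>

lemma shift_equiv_swap:
  assumes "distinct (us @ x # y # vs)" "Suc x \<noteq> y" "Suc y \<noteq> x"
  shows "shift_equiv n k (us @ x # y # vs) (us @ y # x # vs)"
proof -
  let ?P = "\<lambda>z. z = x \<or> z = y" and ?W = "ballot_words n k"
  let ?f = "rev_runs ?P []"
  let ?R = "after (us @ x # y # vs)" and ?R' = "after (us @ y # x # vs)"
  have "x \<noteq> y"
    using assms(1) by auto
  have f: "?f w \<in> ?W" if "w \<in> ?W" for w
    using rev_runs_ballot_words[OF that \<open>x \<noteq> y\<close> assms(2,3)] .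
  have "?f (?f w) = w" for w
    using rev_runs_rev_runs[of ?P "[]" w] by simp
  then have "bij_betw ?f ?W ?W"
    using f by (intro bij_betw_byWitness[where f' = ?f]) auto
  moreover have "adj_count (=) (?f w) = adj_count (=) w" for w
  proof -
    have "adj_count (=) (rev [] @ w) = adj_count (=) (rev_runs ?P [] w)"
      by (rule adj_count_rev_runs) auto
    then show ?thesis
      by simp
  qed
  moreover have "adj_count ?R w = adj_count ?R' (?f w)" for w
  proof -
    have notin: "\<not> before us a c" "\<not> before us c a" "\<not> before vs a c" "\<not> before vs c a"
      if "a = x \<or> a = y" for a c
      using that assms(1) by (auto dest: before_imp_mem)
    have "adj_count ?R (rev [] @ w) = adj_count ?R' (rev_runs ?P [] w)"
      by (rule adj_count_rev_runs) (use assms(1) notin in \<open>auto simp: before_append\<close>)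
    then show ?thesis
      by simp
  qed
  \<comment> \<open>Here \<open>x\<close> and \<open>y\<close> are never neighbours, so the two
    constants agree.\<close>
  moreover have "adj_count ?R [0..<n] = adj_count ?R' [0..<n]"
    by (rule adj_count_upt_cong) (use assms(2,3) in \<open>auto simp: before_append\<close>)
  ultimately show ?thesis
    unfolding shift_equiv_def by (intro exI[of _ ?f]) simp
qed

lemma conj_equiv_imp_shift_equiv:
  assumes "conj_equiv xs ys" "distinct xs" "set xs = {..<n}" "k > 0"
  shows "shift_equiv n k xs ys"
  using assms(1-3)
proof (induction rule: conj_equiv.induct)
  case (refl xs)
  show ?case
    by (rule shift_equiv_refl)
next
  case (swap x y us vs)
  then show ?case
    by (intro shift_equiv_swap)
next
  case (rotate x xs)
  then show ?case
    using assms(4) by (intro shift_equiv_rotate)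
next
  case (trans xs ys zs)
  have "distinct ys" "set ys = {..<n}"
    using trans.prems conj_equiv_mset[OF trans.hyps(1)]
    by (metis mset_eq_imp_distinct_iff, metis mset_eq_setD)
  with trans show ?case
    using shift_equiv_trans by blast
qed

section \<open>Canon permutations as ballot words\<close>

text \<open>Whether a position holds a \<open>j\<close>th copy depends only on the prefix ending
  there, so appending a letter does not affect earlier positions.\<close>

lemma copies_snoc:
  "copies j (w @ [z]) = copies j w @ (if Suc (count_list w z) = j then [z] else [])"
proof -
  let ?A = "\<lambda>w. {p. count_list (take (Suc p) w) (w ! p) = j}"
  have "nths w (?A (w @ [z])) = nths w (?A w)"
    unfolding nths_def
    by (rule arg_cong[where f = "map fst"], rule filter_cong) (auto simp: set_zip nth_append)
  then show ?thesis
    by (simp add: copies_def nths_append)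
qed

lemma copies_append: "\<exists>v'. copies j (u @ v) = copies j u @ v'"
proof (induction v rule: rev_induct)
  case (snoc z v)
  then show ?case
    using copies_snoc[of j "u @ v" z] by auto
qed simp

lemma set_copies:
  assumes "j > 0"
  shows "set (copies j w) = {z. j \<le> count_list w z}"
proof (induction w rule: rev_induct)
  case Nil
  then show ?case
    using assms by (simp add: copies_def)
next
  case (snoc z w)
  have "y \<in> set (copies j (w @ [z])) \<longleftrightarrow> j \<le> count_list (w @ [z]) y" for y
    by (cases "y = z") (simp_all add: copies_snoc snoc.IH le_Suc_eq eq_commute[of j])
  then show ?case
    by blast
qed

lemma count_list_map_inj_on:
  "inj_on f (insert a (set w)) \<Longrightarrow> count_list (map f w) (f a) = count_list w a"
  by (induction w) (auto simp: inj_on_def)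

text \<open>In a ballot word the letters reach their \<open>j\<close>th copy in the order 0, 1, 2,
  ...; at any time those that have done so form an initial segment, of length
  \<open>m\<close>.\<close>

lemma copies_map_nth_ballot:
  assumes "distinct \<sigma>" "length \<sigma> = n" "j > 0"
    and "set w \<subseteq> {..<n}" "\<And>r. Suc r < n \<Longrightarrow> ballot r w"
  shows "\<exists>m\<le>n. copies j (map ((!) \<sigma>) w) = take m \<sigma> \<and> (\<forall>r<n. j \<le> count_list w r \<longleftrightarrow> r < m)"
  using assms(4,5)
proof (induction w rule: rev_induct)
  case Nil
  then show ?case
    using assms(3) by (intro exI[of _ 0]) (auto simp: copies_def)
next
  case (snoc z w)
  have "ballot r w" if "Suc r < n" for r
    using snoc.prems(2)[OF that] by (force simp: ballot_def)
  then obtain m where m: "m \<le> n" "copies j (map ((!) \<sigma>) w) = take m \<sigma>"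
      "\<And>r. r < n \<Longrightarrow> j \<le> count_list w r \<longleftrightarrow> r < m"
    using snoc by auto
  have z: "z < n"
    using snoc.prems by simp
  have cz: "count_list (map ((!) \<sigma>) w) (\<sigma> ! z) = count_list w z"
    using snoc.prems(1) assms(1,2)
    by (intro count_list_map_inj_on inj_on_nth) auto
  show ?case
  proof (cases "Suc (count_list w z) = j")
    case True
    \<comment> \<open>If \<open>z\<close> were beyond \<open>m\<close>, its predecessor would still
      have fewer than \<open>j\<close> copies when \<open>z\<close> gets its
      \<open>j\<close>th.\<close>
    have "z = m"
    proof (rule ccontr)
      assume "z \<noteq> m"
      moreover have "m \<le> z"
        using m(3)[OF z] True by simp
      ultimately obtain r where r: "z = Suc r" "m \<le> r"
        by (cases z) auto
      then have "count_list (w @ [z]) (Suc r) \<le> count_list (w @ [z]) r"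
        using snoc.prems(2)[of r] z unfolding ballot_def by blast
      then show False
        using m(3)[of r] r True z by auto
    qed
    then show ?thesis
      using True m z cz assms(2)
      by (intro exI[of _ "Suc m"])
         (auto simp: copies_snoc take_Suc_conv_app_nth less_Suc_eq)
  next
    case False
    then have "j \<le> count_list (w @ [z]) r \<longleftrightarrow> j \<le> count_list w r" for r
      by auto
    with False m cz show ?thesis
      by (intro exI[of _ m]) (auto simp: copies_snoc)
  qed
qed

lemma canon_perms_at_conv_ballot_words:
  assumes \<sigma>: "\<sigma> \<in> Sym n"
  shows "canon_perms_at n k \<sigma> = map ((!) \<sigma>) ` ballot_words n k"
proof (intro equalityI subsetI)
  have dist: "distinct \<sigma>" and set: "set \<sigma> = {1..n}"
    using \<sigma> by (auto simp: Sym_def permutations_of_set_def)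
  have len: "length \<sigma> = n"
    using distinct_card[OF dist] set by simp
  have img: "(!) \<sigma> ` {..<n} = {1..n}"
    using set len by (auto simp: set_conv_nth)
  have count_map: "count_list (map ((!) \<sigma>) w) (\<sigma> ! r) = count_list w r"
    if "set w \<subseteq> {..<n}" "r < n" for w r
    using that dist len by (intro count_list_map_inj_on inj_on_nth) auto
  {
    fix \<pi> assume "\<pi> \<in> canon_perms_at n k \<sigma>"
    then have mset: "mset \<pi> = repeat_mset k (mset_set {1..n})"
      and copies: "\<And>j. j \<in> {1..k} \<Longrightarrow> copies j \<pi> = \<sigma>"
      by (auto simp: canon_perms_at_def canon_perms_def permutations_of_multiset_def)
    have "set \<pi> \<subseteq> {1..n}"
      using mset by (metis count_repeat_mset count_mset_set(3) mult_0_right not_in_iff set_mset_mset subsetI)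
    then have "\<pi> \<in> lists ((!) \<sigma> ` {..<n})"
      unfolding img by auto
    then obtain w where w: "\<pi> = map ((!) \<sigma>) w" "set w \<subseteq> {..<n}"
      unfolding lists_image by auto
    have "count_list w r = k" if "r < n" for r
    proof -
      have "\<sigma> ! r \<in> {1..n}"
        using that img by blast
      then have "count (mset \<pi>) (\<sigma> ! r) = k"
        by (simp add: mset)
      with count_map[OF w(2) that] show ?thesis
        by (simp add: w(1) count_mset del: mset_map)
    qed
    note count = this
    moreover have "ballot r w" if r: "Suc r < n" for r
      unfolding ballot_def
    proof (intro allI impI)
      fix u v assume uv: "w = u @ v"
      \<comment> \<open>The \<open>j\<close>th copies read so far form a prefix of \<sigma>. It
        contains the value at \<open>Suc r\<close>, hence also the one at \<open>r\<close>, so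
        \<open>r\<close> occurs at least \<open>j\<close> times in \<open>u\<close>. For
        \<open>j = 0\<close> the bound is trivial.\<close>
      define j where "j = count_list u (Suc r)"
      show "count_list u (Suc r) \<le> count_list u r"
      proof (cases "j = 0")
        case False
        have u: "set u \<subseteq> {..<n}"
          using w(2) uv by auto
        have "j \<le> k"
          using count[OF r] uv by (simp add: j_def)
        then have "copies j (map ((!) \<sigma>) u @ map ((!) \<sigma>) v) = \<sigma>"
          using copies[of j] False w(1) uv by simp
        then obtain m where m: "copies j (map ((!) \<sigma>) u) = take m \<sigma>"
          using copies_append[of j "map ((!) \<sigma>) u" "map ((!) \<sigma>) v"] by (metis append_eq_conv_conj)
        have mem: "\<sigma> ! i \<in> set (take m \<sigma>) \<longleftrightarrow> j \<le> count_list u i" if "i < n" for i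
          using set_copies[of j "map ((!) \<sigma>) u"] False count_map[OF u that] by (simp add: m)
        from mem[OF r] obtain i where "i < m" "i < n" "\<sigma> ! i = \<sigma> ! Suc r"
          by (auto simp: j_def set_conv_nth len)
        then have "Suc r < m"
          using dist len r by (simp add: nth_eq_iff_index_eq)
        then have "\<sigma> ! r \<in> set (take m \<sigma>)"
          using r len nth_mem[of r "take m \<sigma>"] by simp
        then show ?thesis
          using mem[of r] r by (simp add: j_def)
      qed (simp add: j_def)
    qed
    ultimately show "\<pi> \<in> map ((!) \<sigma>) ` ballot_words n k"
      using w by (auto simp: ballot_words_def)
  }
  {
    fix \<pi> assume "\<pi> \<in> map ((!) \<sigma>) ` ballot_words n k"
    then obtain w where \<pi>: "\<pi> = map ((!) \<sigma>) w" and w: "w \<in> ballot_words n k"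
      by blast
    have ws: "set w \<subseteq> {..<n}"
      using w by (simp add: ballot_words_def)
    have "mset \<pi> = repeat_mset k (mset_set {1..n})"
    proof (rule multiset_eqI)
      fix x
      show "count (mset \<pi>) x = count (repeat_mset k (mset_set {1..n})) x"
      proof (cases "x \<in> {1..n}")
        case True
        then obtain r where "r < n" "x = \<sigma> ! r"
          using img by blast
        then show ?thesis
          using True count_map[OF ws, of r] w
          by (simp add: \<pi> ballot_words_def count_mset del: mset_map)
      next
        case False
        then have "x \<notin> set \<pi>"
          using img ws unfolding \<pi> by (metis imageE image_mono list.set_map subsetD)
        with False show ?thesis
          by (simp add: count_mset_0_iff)
      qed
    qed
    moreover have "copies j \<pi> = \<sigma>" if j: "j \<in> {1..k}" for j
    proof -
      obtain m where "copies j \<pi> = take m \<sigma>" "m \<le> n" "\<And>r. r < n \<Longrightarrow> j \<le> count_list w r \<longleftrightarrow> r < m"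
        using copies_map_nth_ballot[of \<sigma> n j w] dist len j w unfolding \<pi>
        by (auto simp: ballot_words_def)
      \<comment> \<open>Every letter occurs \<open>k\<close> times and \<open>j \<le> k\<close>, so
        no letter is missing from the initial segment.\<close>
      moreover have "m \<ge> n"
        using calculation(3)[of m] w j by (force simp: ballot_words_def not_less)
      ultimately show ?thesis
        using len by simp
    qed
    ultimately show "\<pi> \<in> canon_perms_at n k \<sigma>"
      using \<sigma> by (auto simp: canon_perms_at_def canon_perms_def permutations_of_multiset_def)
  }
qed

section \<open>Tableaux as ballot words\<close>

definition tableau_of_word :: "nat \<Rightarrow> nat list \<Rightarrow> nat list list" where
  "tableau_of_word n w = map (\<lambda>r. filter (\<lambda>i. w ! (i - 1) = r) [1..<Suc (length w)]) [0..<n]"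

text \<open>The elements up to \<open>p\<close> form a prefix of an increasing list. This trades
  counts of letters for entries of a tableau row.\<close>

lemma less_length_filter_le_iff:
  fixes xs :: "'a::linorder list"
  assumes "sorted_wrt (<) xs"
  shows "c < length (filter (\<lambda>i. i \<le> p) xs) \<longleftrightarrow> c < length xs \<and> xs ! c \<le> p"
  using assms
proof (induction xs arbitrary: c)
  case (Cons a xs)
  show ?case
  proof (cases "a \<le> p")
    case True
    with Cons show ?thesis
      by (cases c) auto
  next
    case False
    then have "\<not> b \<le> p" if "b \<in> set (a # xs)" for b
      using Cons.prems that by fastforce
    then show ?thesis
      by (metis filter_False length_0_conv not_less0 nth_mem)
  qed
qed simp

lemma count_list_map_conv_filter: "count_list (map f xs) a = length (filter (\<lambda>x. f x = a) xs)"
  by (induction xs) auto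

lemma length_filter_positions:
  assumes "p \<le> length w"
  shows "length (filter (\<lambda>i. i \<le> p) (filter (\<lambda>i. w ! (i - 1) = r) [1..<Suc (length w)])) =
         count_list (take p w) r"
proof -
  have "[1..<Suc (length w)] = [1..<Suc p] @ [Suc p..<Suc (length w)]"
    using assms upt_add_eq_append[of 1 "Suc p" "length w - p"] by simp
  then have *: "filter (\<lambda>i. i \<le> p) [1..<Suc (length w)] = [1..<Suc p]"
    by (simp del: upt_Suc add: filter_empty_conv filter_id_conv)
  have "take p w = map (\<lambda>i. w ! (i - 1)) [1..<Suc p]"
    using assms by (intro nth_equalityI) (auto simp del: upt_Suc)
  then have "count_list (take p w) r = length (filter (\<lambda>i. w ! (i - 1) = r) [1..<Suc p])"
    by (simp only: count_list_map_conv_filter)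
  also have "\<dots> = length (filter (\<lambda>i. w ! (i - 1) = r) (filter (\<lambda>i. i \<le> p) [1..<Suc (length w)]))"
    by (simp only: *)
  finally show ?thesis
    by (simp add: conj_commute del: upt_Suc)
qed

lemma sorted_wrt_filter_upt: "sorted_wrt (<) (filter P [a..<b::nat])"
  by (simp add: sorted_wrt_filter)

text \<open>More than \<open>c\<close> copies of \<open>r\<close> occur among the first
  \<open>p\<close> letters iff \<open>R ! c \<le> p\<close>, and likewise for \<open>Suc r\<close>
  and \<open>R'\<close>. Taking \<open>p = R' ! c\<close> gives the weak column inequality; it is
  strict because a position carries only one letter.\<close>

lemma ballot_iff_columns:
  fixes w :: "nat list" and r :: nat
  defines "R \<equiv> filter (\<lambda>i. w ! (i - 1) = r) [1..<Suc (length w)]"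
    and "R' \<equiv> filter (\<lambda>i. w ! (i - 1) = Suc r) [1..<Suc (length w)]"
  assumes len: "length R = k" "length R' = k"
  shows "ballot r w \<longleftrightarrow> (\<forall>c<k. R ! c < R' ! c)"
proof -
  have le_iff: "c < count_list (take p w) r \<longleftrightarrow> c < k \<and> R ! c \<le> p"
      "c < count_list (take p w) (Suc r) \<longleftrightarrow> c < k \<and> R' ! c \<le> p" if "p \<le> length w" for c p
    using len
    unfolding R_def R'_def by (simp_all flip: length_filter_positions[OF that] del: upt_Suc filter_filter
        add: less_length_filter_le_iff[OF sorted_wrt_filter_upt])
  have mem: "R ! c \<in> set R" "R' ! c \<in> set R'" if "c < k" for c
    using that len by auto
  have "ballot r w \<longleftrightarrow> (\<forall>p\<le>length w. count_list (take p w) (Suc r) \<le> count_list (take p w) r)"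
    unfolding ballot_def
    by (metis append_eq_conv_conj append_take_drop_id le_add1 length_append)
  also have "\<dots> \<longleftrightarrow> (\<forall>c<k. R ! c < R' ! c)"
  proof (intro iffI allI impI)
    fix c assume b: "\<forall>p\<le>length w. count_list (take p w) (Suc r) \<le> count_list (take p w) r" and c: "c < k"
    have p: "R' ! c \<le> length w"
      using mem(2)[OF c] by (auto simp: R'_def simp del: upt_Suc)
    then have "R ! c \<le> R' ! c"
      using le_iff[OF p] b c by (meson le_refl less_le_trans)
    moreover have "R ! c \<noteq> R' ! c"
      using mem[OF c] by (auto simp: R_def R'_def simp del: upt_Suc)
    ultimately show "R ! c < R' ! c"
      by simp
  next
    fix p assume col: "\<forall>c<k. R ! c < R' ! c" and p: "p \<le> length w"
    have "c < count_list (take p w) r" if "c < count_list (take p w) (Suc r)" for c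
      using that col le_iff[OF p] by (meson less_imp_le order_trans)
    then show "count_list (take p w) (Suc r) \<le> count_list (take p w) r"
      by (meson less_irrefl not_less)
  qed
  finally show ?thesis .
qed

lemma length_row_of_word:
  "length (filter (\<lambda>i. w ! (i - 1) = r) [1..<Suc (length w)]) = count_list w r"
proof -
  have "filter (\<lambda>i. i \<le> length w) [1..<Suc (length w)] = [1..<Suc (length w)]"
    by (simp add: filter_id_conv del: upt_Suc)
  with length_filter_positions[of "length w" w r] show ?thesis
    by (metis (no_types, lifting) filter_filter filter_cong conj_commute order_refl take_all)
qed

lemma tableau_of_word_in_SYT:
  assumes w: "w \<in> ballot_words n k"
  shows "tableau_of_word n w \<in> SYT_rect n k"
proof -
  define T where "T = tableau_of_word n w"
  have len: "length T = n"
    by (simp add: T_def tableau_of_word_def)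
  have nth: "T ! r = filter (\<lambda>i. w ! (i - 1) = r) [1..<Suc (length w)]" if "r < n" for r
    using that by (simp add: T_def tableau_of_word_def del: upt_Suc)
  have lenr: "length (T ! r) = k" if "r < n" for r
    using w that length_row_of_word[of w r] by (simp add: nth ballot_words_def del: upt_Suc)
  have "set (concat T) = {1..k * n}"
  proof (intro equalityI subsetI)
    fix i assume i: "i \<in> {1..k * n}"
    then have "i - 1 < length w"
      using length_ballot_words[OF w] by auto
    then have "w ! (i - 1) < n"
      using w nth_mem unfolding ballot_words_def by blast
    then show "i \<in> set (concat T)"
      using i length_ballot_words[OF w]
      by (auto simp: T_def tableau_of_word_def simp del: upt_Suc)
  qed (auto simp: T_def tableau_of_word_def length_ballot_words[OF w] simp del: upt_Suc)
  moreover have "T ! r ! c < T ! r ! Suc c" if "r < n" "Suc c < k" for r c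
  proof -
    have "sorted_wrt (<) (T ! r)"
      using that(1) by (simp only: nth sorted_wrt_filter_upt)
    from sorted_wrt_nth_less[OF this, of c "Suc c"] show ?thesis
      using that lenr by simp
  qed
  moreover have "T ! r ! c < T ! Suc r ! c" if "c < k" "Suc r < n" for r c
    using ballot_iff_columns[of w r k] that lenr[of r] lenr[of "Suc r"] w
    by (simp add: nth ballot_words_def del: upt_Suc)
  moreover have "length R = k" if "R \<in> set T" for R
    using that lenr len by (metis in_set_conv_nth)
  ultimately have "T \<in> SYT_rect n k"
    using len by (simp add: SYT_rect_def)
  then show ?thesis
    by (simp add: T_def)
qed

lemma row_tableau_of_word:
  assumes "i \<in> {1..length w}" "set w \<subseteq> {..<n}"
  shows "row (tableau_of_word n w) i = Suc (w ! (i - 1))"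
proof -
  have "w ! (i - 1) < n"
    using nth_mem[of "i - 1" w] subsetD[OF assms(2)] assms(1) by fastforce
  then show ?thesis
    unfolding row_def using assms
    by (intro the_equality) (auto simp: tableau_of_word_def simp del: upt_Suc)
qed

lemma distinct_concat_nth_unique:
  "distinct (concat xss) \<Longrightarrow> r < length xss \<Longrightarrow> s < length xss \<Longrightarrow>
    x \<in> set (xss ! r) \<Longrightarrow> x \<in> set (xss ! s) \<Longrightarrow> r = s"
proof (induction xss arbitrary: r s)
  case (Cons xs xss)
  have "x \<notin> set xs" if "i < length xss" "x \<in> set (xss ! i)" for i
    using Cons.prems(1) that(2) nth_mem[OF that(1)] by fastforce
  with Cons show ?case
    by (cases r; cases s) auto
qed simp

lemma length_concat_SYT_rect:
  assumes "T \<in> SYT_rect n k"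
  shows "length (concat T) = k * n"
proof -
  have "sum_list (map length T) = sum_list (map (\<lambda>_. k) T)"
    using assms by (intro arg_cong[where f = sum_list] map_cong) (auto simp: SYT_rect_def)
  then show ?thesis
    using assms by (simp add: length_concat sum_list_triv SYT_rect_def mult.commute)
qed

text \<open>The preimage of \<open>T\<close> records the rows of 1, 2, ... in turn. The rows agree
  because strictly increasing lists with the same elements are equal.\<close>

lemma SYT_rect_conv_ballot_words: "SYT_rect n k = tableau_of_word n ` ballot_words n k"
proof (intro equalityI subsetI)
  fix T assume T: "T \<in> SYT_rect n k"
  have lenT: "length T = n" and lenr: "\<And>r. r < n \<Longrightarrow> length (T ! r) = k"
    and set: "set (concat T) = {1..k * n}"
    using T by (auto simp: SYT_rect_def)
  \<comment> \<open>There are as many values as cells, so no entry repeats and \<open>row\<close> is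
    well defined.\<close>
  have dist: "distinct (concat T)"
    using set length_concat_SYT_rect[OF T] by (intro card_distinct) simp
  have row: "row T i = Suc r" if "i \<in> set (T ! r)" "r < n" for i r
    unfolding row_def
  proof (rule the_equality)
    fix s assume "s \<in> {1..length T} \<and> i \<in> set (T ! (s - 1))"
    then show "s = Suc r"
      using distinct_concat_nth_unique[OF dist, of r "s - 1" i] that lenT by auto
  qed (use that lenT in auto)
  have ex_row: "\<exists>r<n. i \<in> set (T ! r)" if i: "i \<in> {1..k * n}" for i
  proof -
    obtain R where "R \<in> set T" "i \<in> set R"
      using i unfolding set[symmetric] set_concat by blast
    then show ?thesis
      using lenT by (metis in_set_conv_nth)
  qed
  define w where "w = map (\<lambda>i. row T i - 1) [1..<Suc (k * n)]"
  have lenw: "length w = k * n"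
    by (simp add: w_def del: upt_Suc)
  have w_nth: "w ! (i - 1) = row T i - 1" if "i \<in> {1..k * n}" for i
    using that by (auto simp: w_def simp del: upt_Suc)
  have T_nth: "T ! r = filter (\<lambda>i. w ! (i - 1) = r) [1..<Suc (length w)]" if r: "r < n" for r
  proof (rule strict_sorted_equal[symmetric])
    show "sorted_wrt (<) (T ! r)"
      using T r lenr by (auto simp: sorted_wrt_iff_nth_Suc_transp SYT_rect_def)
    show "sorted_wrt (<) (filter (\<lambda>i. w ! (i - 1) = r) [1..<Suc (length w)])"
      by (rule sorted_wrt_filter_upt)
    have sub: "set (T ! r) \<subseteq> {1..k * n}"
      using r lenT nth_mem unfolding set[symmetric] set_concat by blast
    show "set (filter (\<lambda>i. w ! (i - 1) = r) [1..<Suc (length w)]) = set (T ! r)"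
    proof (intro equalityI subsetI)
      fix i assume "i \<in> set (filter (\<lambda>i. w ! (i - 1) = r) [1..<Suc (length w)])"
      then have i: "i \<in> {1..k * n}" "w ! (i - 1) = r"
        by (auto simp: lenw simp del: upt_Suc)
      with ex_row[OF i(1)] row w_nth[OF i(1)] show "i \<in> set (T ! r)"
        by auto
    next
      fix i assume i: "i \<in> set (T ! r)"
      with sub have "i \<in> {1..k * n}"
        by blast
      with row[OF i r] w_nth show "i \<in> set (filter (\<lambda>i. w ! (i - 1) = r) [1..<Suc (length w)])"
        by (auto simp: lenw simp del: upt_Suc)
    qed
  qed
  have "tableau_of_word n w = T"
    by (rule nth_equalityI) (auto simp: tableau_of_word_def T_nth lenT simp del: upt_Suc)
  moreover have "w \<in> ballot_words n k"
    unfolding ballot_words_def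
  proof (intro CollectI conjI allI impI)
    show "set w \<subseteq> {..<n}"
      using ex_row row by (fastforce simp: w_def simp del: upt_Suc)
    show "count_list w r = k" if "r < n" for r
      using lenr[OF that] T_nth[OF that] length_row_of_word[of w r] by simp
    show "ballot r w" if r: "Suc r < n" for r
    proof -
      have "\<forall>c<k. T ! r ! c < T ! Suc r ! c"
        using T r by (simp add: SYT_rect_def)
      then show ?thesis
        using ballot_iff_columns[of w r k, folded T_nth[OF Suc_lessD[OF r]] T_nth[OF r]] lenr r
        by simp
    qed
  qed
  ultimately show "T \<in> tableau_of_word n ` ballot_words n k"
    by blast
qed (auto simp: tableau_of_word_in_SYT)

lemma inj_on_tableau_of_word: "inj_on (tableau_of_word n) (ballot_words n k)"
proof (rule inj_onI, rule nth_equalityI)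
  fix v w assume v: "v \<in> ballot_words n k" and w: "w \<in> ballot_words n k"
    and eq: "tableau_of_word n v = tableau_of_word n w"
  show len: "length v = length w"
    using v w by (simp add: length_ballot_words)
  fix i assume "i < length v"
  then show "v ! i = w ! i"
    using row_tableau_of_word[of "Suc i" v n] row_tableau_of_word[of "Suc i" w n] eq len v w
    by (auto simp: ballot_words_def)
qed

lemma
  assumes w: "w \<in> ballot_words n k"
  shows asc_tableau_of_word: "asc_tab (tableau_of_word n w) = adj_count (>) w"
    and plat_tableau_of_word: "plat_tab (tableau_of_word n w) = adj_count (=) w"
proof -
  let ?T = "tableau_of_word n w"
  have len: "length (concat ?T) = length w"
    using length_concat_SYT_rect[OF tableau_of_word_in_SYT[OF w]] length_ballot_words[OF w]
    by simp
  have row: "row ?T i = Suc (w ! (i - 1))" "row ?T (i + 1) = Suc (w ! i)"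
    if "i \<in> {1..length w - 1}" for i
    using that w row_tableau_of_word[of i w n] row_tableau_of_word[of "i + 1" w n]
    by (auto simp: ballot_words_def)
  show "asc_tab ?T = adj_count (>) w" "plat_tab ?T = adj_count (=) w"
    unfolding asc_tab_def Asc_tab_def plat_tab_def Plat_tab_def adj_count_conv_card len
    using row by (auto intro!: arg_cong[where f = card])
qed

lemma narayana_poly_conv_ballot_words:
  "narayana_poly n k = (\<Sum>w\<in>ballot_words n k. monom_tu (adj_count (>) w) (adj_count (=) w))"
  unfolding narayana_poly_def SYT_rect_conv_ballot_words
  by (subst sum.reindex[OF inj_on_tableau_of_word])
     (simp add: asc_tableau_of_word plat_tableau_of_word)

section \<open>Assembling the polynomial identities\<close>

lemma canon_poly_at_eq:
  assumes \<sigma>: "\<sigma> \<in> Sym n" and k: "k > 0"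
  shows "canon_poly_at n k \<sigma> = [:monom 1 (des \<sigma>):] * narayana_poly n k"
proof -
  let ?W = "ballot_words n k"
  have dist: "distinct \<sigma>" and set: "set \<sigma> = {1..n}"
    using \<sigma> by (auto simp: Sym_def permutations_of_set_def)
  have len: "length \<sigma> = n"
    using distinct_card[OF dist] set by simp
  have inj: "inj_on ((!) \<sigma>) {..<n}"
    using dist len by (intro inj_on_nth) auto
  define \<tau> where "\<tau> = sort_key ((!) \<sigma>) [0..<n]"
  have \<tau>: "distinct \<tau>" "set \<tau> = {..<n}"
    by (auto simp: \<tau>_def)
  have "sorted_wrt (<) (map ((!) \<sigma>) \<tau>)"
    using \<tau> inj by (auto simp: strict_sorted_iff distinct_map \<tau>_def)
  then have before_iff: "before \<tau> a b \<longleftrightarrow> \<sigma> ! a < \<sigma> ! b" if "a < n" "b < n" for a b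
    using that \<tau>(2) by (intro before_sorted_wrt) (auto simp: sorted_wrt_map)
  have des: "des (map ((!) \<sigma>) w) = adj_count (after \<tau>) w" if "set w \<subseteq> {..<n}" for w
    unfolding des_conv_adj_count adj_count_map using that before_iff by (intro adj_count_cong) auto
  have plat: "plat (map ((!) \<sigma>) w) = adj_count (=) w" if "set w \<subseteq> {..<n}" for w
    unfolding plat_conv_adj_count adj_count_map using that inj by (intro adj_count_cong) (auto simp: inj_on_def)
  have "shift_equiv n k \<tau> [0..<n]"
    using \<tau> k by (intro conj_equiv_imp_shift_equiv conj_equiv_upt)
  then obtain \<phi> where \<phi>: "bij_betw \<phi> ?W ?W"
    and \<phi>_plat: "\<And>w. w \<in> ?W \<Longrightarrow> adj_count (=) (\<phi> w) = adj_count (=) w"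
    and \<phi>_des: "\<And>w. w \<in> ?W \<Longrightarrow> adj_count (after \<tau>) w + adj_count (after [0..<n]) [0..<n] =
      adj_count (after [0..<n]) (\<phi> w) + adj_count (after \<tau>) [0..<n]"
    unfolding shift_equiv_def by blast
  have upt: "adj_count (after [0..<n]) w = adj_count (>) w" if "set w \<subseteq> {..<n}" for w
    using that before_sorted_wrt[of id "[0..<n]"] by (intro adj_count_cong) auto
  \<comment> \<open>The target order is the usual one, for which the increasing word has no
    descents; so its constant vanishes.\<close>
  have "adj_count (after [0..<n]) [0..<n] = adj_count (\<lambda>_ _. False) [0..<n]"
    by (subst upt) (auto intro!: adj_count_upt_cong)
  then have upt_0: "adj_count (after [0..<n]) [0..<n] = 0"
    by (simp add: adj_count_conv_card)
  \<comment> \<open>The increasing word is sent to \<sigma> itself, so the remaining constant is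
    \<open>des \<sigma>\<close>.\<close>
  have "adj_count (after \<tau>) [0..<n] = des (map ((!) \<sigma>) [0..<n])"
    by (rule des[symmetric]) auto
  then have \<sigma>_des: "adj_count (after \<tau>) [0..<n] = des \<sigma>"
    using len map_nth[of \<sigma>] by simp
  have stats: "des (map ((!) \<sigma>) w) = des \<sigma> + adj_count (>) (\<phi> w) \<and>
      plat (map ((!) \<sigma>) w) = adj_count (=) (\<phi> w)" if w: "w \<in> ?W" for w
  proof -
    have "\<phi> w \<in> ?W"
      using \<phi> w by (rule bij_betw_apply)
    then show ?thesis
      using w \<phi>_des[OF w] \<phi>_plat[OF w] upt_0 \<sigma>_des
      by (simp add: des plat upt ballot_words_def)
  qed
  have inj_map: "inj_on (map ((!) \<sigma>)) ?W"
    by (intro inj_on_mapI inj_on_subset[OF inj]) (auto simp: ballot_words_def)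
  have "canon_poly_at n k \<sigma> = (\<Sum>w\<in>?W. monom_tu (des \<sigma> + adj_count (>) (\<phi> w)) (adj_count (=) (\<phi> w)))"
    unfolding canon_poly_at_def canon_perms_at_conv_ballot_words[OF \<sigma>]
    by (subst sum.reindex[OF inj_map]) (simp add: stats)
  also have "\<dots> = (\<Sum>w\<in>?W. monom_tu (des \<sigma> + adj_count (>) w) (adj_count (=) w))"
    by (rule sum.reindex_bij_betw[OF \<phi>])
  also have "\<dots> = [:monom 1 (des \<sigma>):] * narayana_poly n k"
    by (simp add: narayana_poly_conv_ballot_words sum_distrib_left monom_tu_def
        smult_monom mult_monom)
  finally show ?thesis .
qed

theorem theorem3p1:
  fixes n k :: nat
  assumes "n \<ge> 1" and "k \<ge> 1"
  shows "canon_poly n k = [:eulerian_poly n:] * narayana_poly n k \<and>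
         (\<forall>\<sigma>\<in>Sym n. canon_poly_at n k \<sigma> = [:monom 1 (des \<sigma>):] * narayana_poly n k)"
proof
  have at: "canon_poly_at n k \<sigma> = [:monom 1 (des \<sigma>):] * narayana_poly n k" if "\<sigma> \<in> Sym n" for \<sigma>
    using that assms(2) by (intro canon_poly_at_eq) auto
  then show "\<forall>\<sigma>\<in>Sym n. canon_poly_at n k \<sigma> = [:monom 1 (des \<sigma>):] * narayana_poly n k"
    by blast
  have fin: "finite (Sym n)"
    by (simp add: Sym_def)
  have union: "canon_perms n k = (\<Union>\<sigma>\<in>Sym n. canon_perms_at n k \<sigma>)"
    by (auto simp: canon_perms_at_def canon_perms_def)
  \<comment> \<open>Since \<open>k \<ge> 1\<close>, the subsequence of first copies determines
    \<sigma>.\<close>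
  have "canon_perms_at n k \<sigma> \<inter> canon_perms_at n k \<sigma>' = {}" if "\<sigma> \<noteq> \<sigma>'" for \<sigma> \<sigma>'
    using that assms(2) by (force simp: canon_perms_at_def)
  moreover have "finite (canon_perms_at n k \<sigma>)" for \<sigma>
    by (rule finite_subset[of _ "permutations_of_multiset (repeat_mset k (mset_set {1..n}))"])
       (auto simp: canon_perms_at_def canon_perms_def)
  ultimately have "canon_poly n k = (\<Sum>\<sigma>\<in>Sym n. canon_poly_at n k \<sigma>)"
    unfolding canon_poly_def canon_poly_at_def union
    using fin by (intro sum.UNION_disjoint) auto
  also have "\<dots> = (\<Sum>\<sigma>\<in>Sym n. [:monom 1 (des \<sigma>):]) * narayana_poly n k"
    by (simp add: at sum_distrib_right)
  also have "(\<Sum>\<sigma>\<in>Sym n. [:monom 1 (des \<sigma>):]) = [:eulerian_poly n:]"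
    unfolding eulerian_poly_def by (induction rule: infinite_finite_induct) auto
  finally show "canon_poly n k = [:eulerian_poly n:] * narayana_poly n k" .
qed

end
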